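(* Let $\Theta_0^C\in\mathbb{R}^p$ be arbitrary, and let $(\Theta_i^M)_{i\ge 0}$ and $(\Theta_i^C)_{i\ge 0}$ be sequences of weight vectors in $\mathbb{R}^p$ obtained by consecutive application of the alternating scheme $$\Theta_i^M = \mathcal{P}_{\mathcal{M}}\,\Theta_i^C,\qquad \Theta_{i+1}^C=\mathcal{P}_{\mathcal{C}}\,\Theta_i^M\qquad (i=0,1,2,\dots),$$ where $\mathcal{P}_{\mathcal{M}}$ maps a weight vector to a nearest local minimum of the training loss and $\mathcal{P}_{\mathcal{C}}$ maps a weight vector to a nearest weight vector satisfying the count constraint, as defined in the context. Then the sequence of real numbers $\bigl(\Vert \Theta_i^C-\Theta_i^M\Vert_2\bigr)_{i\ge 1}$ converges.
   Context: Data: a training set $X=(x_1,\dots,x_n)$ with $x_i\in\mathbb{R}^d$, labels $Y=(y_1,\dots,y_n)$ with $y_i\in\mathbb{R}$, an integer $m\le n$, and a tolerance $\delta\ge 0$. A neural network with weights $\Theta\in\mathbb{R}^p$ is a function giving, for each input $x\in\mathbb{R}^d$, a real prediction $N(\Theta,x)$; write $N(\Theta,X)=(N(\Theta,x_1),\dots,N(\Theta,x_n))$. A real-valued loss function $\mathcal{L}(N(\Theta,X);Y)$ is given. $\Vert\cdot\Vert_2$ is the Euclidean norm on $\mathbb{R}^p$. Set of local minima: $\mathcal{M}\subset\mathbb{R}^p$ is the set of weight vectors that are local minima of the function $\Theta\mapsto\mathcal{L}(N(\Theta,X);Y)$. Count-constraint set: $\operatorname{count}_i(\cdot)$ is the number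 of indices $i\in\{1,\dots,n\}$ for which the condition inside holds, and $$\mathcal{C}=\Bigl\{\Theta\in\mathbb{R}^p \;:\; \bigl|\operatorname{count}_i\bigl(N(\Theta,x_i)\ge y_i\bigr)-m\bigr|\le\delta\Bigr\}.$$ Operators: $\mathcal{P}_{\mathcal{M}}\Theta\in\operatorname{argmin}_{\hat\Theta\in\mathcal{M}}\Vert\Theta-\hat\Theta\Vert_2$ is a nearest point of $\mathcal{M}$ to $\Theta$, and $\mathcal{P}_{\mathcal{C}}\Theta\in\operatorname{argmin}_{\hat\Theta\in\mathcal{C}}\Vert\Theta-\hat\Theta\Vert_2$ is a nearest point of $\mathcal{C}$ to $\Theta$. It is part of the setting that these minimizers exist at the points where the operators are applied (if there are several, any one of them is returned). *)

theory Defs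
  imports "HOL-Analysis.Analysis"
begin

definition local_minimum :: "('a::metric_space \<Rightarrow> real) \<Rightarrow> 'a \<Rightarrow> bool" where
  "local_minimum f a \<longleftrightarrow> (\<exists>e>0. \<forall>b\<in>ball a e. f a \<le> f b)"

text \<open>
  The index type \<open>'n\<close> enumerates the training samples, so the number of samples is
  \<open>CARD('n)\<close>; \<open>real ^ 'p\<close> is the space of weights and \<open>real ^ 'd\<close> the space of inputs.
\<close>

definition predictions ::
    "(real ^ 'p \<Rightarrow> real ^ 'd \<Rightarrow> real) \<Rightarrow> (real ^ 'd) ^ 'n \<Rightarrow> real ^ 'p \<Rightarrow> real ^ 'n" where
  "predictions N X \<Theta> = (\<chi> i. N \<Theta> (X $ i))"

definition loss_minima ::
    "(real ^ 'n \<Rightarrow> real ^ 'n \<Rightarrow> real) \<Rightarrow> (real ^ 'p \<Rightarrow> real ^ 'd \<Rightarrow> real) \<Rightarrow>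
     (real ^ 'd) ^ 'n \<Rightarrow> real ^ 'n \<Rightarrow> (real ^ 'p) set" where
  "loss_minima L N X Y = {\<Theta>. local_minimum (\<lambda>\<Theta>'. L (predictions N X \<Theta>') Y) \<Theta>}"

definition count_constraint ::
    "(real ^ 'p \<Rightarrow> real ^ 'd \<Rightarrow> real) \<Rightarrow> (real ^ 'd) ^ 'n \<Rightarrow> real ^ 'n \<Rightarrow>
     int \<Rightarrow> real \<Rightarrow> (real ^ 'p) set" where
  "count_constraint N X Y m \<delta> =
     {\<Theta>. \<bar>real (card {i. N \<Theta> (X $ i) \<ge> Y $ i}) - real_of_int m\<bar> \<le> \<delta>}"

text \<open>
  The set of all nearest points. Applying a projection operator means choosing any element of
  this set; unlike \<^const>\<open>closest_point\<close>, no particular choice is fixed, and membership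
  includes the existence of a minimizer.
\<close>

definition nearest_points :: "'a::real_normed_vector set \<Rightarrow> 'a \<Rightarrow> 'a set" where
  "nearest_points S \<Theta> = {a. is_arg_min (\<lambda>b. norm (\<Theta> - b)) (\<lambda>b. b \<in> S) a}"

end

theory Submission
  imports Defs
begin

text \<open>Each projection can only shrink the gap between the two iterates: the previous iterate
  in the target set is still an admissible competitor, so a nearest point is at least as close. The
  gaps thus form a nonincreasing sequence of reals bounded below by 0, which converges. Only the
  gaps are controlled, not the iterates themselves.\<close>

lemma nearest_pointsD:
  assumes "a \<in> nearest_points S x"
  shows "a \<in> S" and "\<And>b. b \<in> S \<Longrightarrow> norm (x - a) \<le> norm (x - b)"
  using assms by (auto simp: nearest_points_def is_arg_min_linorder)

text \<open>The shift to \<open>Suc i\<close> matters: the starting point \<open>b 0\<close> is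
  arbitrary and may lie outside \<open>B\<close>, so the first gap may be smaller than the next
  one.\<close>

lemma alternating_nearest_points_convergent:
  fixes a b :: "nat \<Rightarrow> 'a::real_normed_vector"
  assumes a: "\<And>i. a i \<in> nearest_points A (b i)"
    and b: "\<And>i. b (Suc i) \<in> nearest_points B (a i)"
  shows "convergent (\<lambda>i. norm (b (Suc i) - a (Suc i)))"
proof -
  let ?d = "\<lambda>i. norm (b (Suc i) - a (Suc i))"
  have "?d (Suc i) \<le> ?d i" for i
  proof -
    \<comment> \<open>The old point \<open>a (Suc i)\<close> of \<open>A\<close> competes with the
      new projection \<open>a (Suc (Suc i))\<close>.\<close>
    have "?d (Suc i) \<le> norm (b (Suc (Suc i)) - a (Suc i))"
      by (rule nearest_pointsD(2)[OF a nearest_pointsD(1)[OF a]])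
    also have "\<dots> = norm (a (Suc i) - b (Suc (Suc i)))"
      by (rule norm_minus_commute)
    \<comment> \<open>Here the competitor is \<open>b (Suc i)\<close>, which lies in
      \<open>B\<close> because it is itself a projection.\<close>
    also have "\<dots> \<le> norm (a (Suc i) - b (Suc i))"
      by (rule nearest_pointsD(2)[OF b nearest_pointsD(1)[OF b]])
    also have "\<dots> = ?d i"
      by (rule norm_minus_commute)
    finally show ?thesis .
  qed
  then have "decseq ?d"
    by (rule decseq_SucI)
  then show ?thesis
    by (rule decseq_convergent[where B = 0]) (auto simp: convergent_def)
qed

theorem proposition2p1:
  fixes X :: "(real ^ 'd) ^ 'n"
    and Y :: "real ^ 'n"
    and m :: int
    and \<delta> :: real
    and N :: "real ^ 'p \<Rightarrow> real ^ 'd \<Rightarrow> real"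
    and L :: "real ^ 'n \<Rightarrow> real ^ 'n \<Rightarrow> real"
    and \<Theta>M \<Theta>C :: "nat \<Rightarrow> real ^ 'p"
  assumes "m \<le> int CARD('n)"
    and "\<delta> \<ge> 0"
    and "\<And>i. \<Theta>M i \<in> nearest_points (loss_minima L N X Y) (\<Theta>C i)"
    and "\<And>i. \<Theta>C (Suc i) \<in> nearest_points (count_constraint N X Y m \<delta>) (\<Theta>M i)"
  shows "convergent (\<lambda>i. norm (\<Theta>C (Suc i) - \<Theta>M (Suc i)))"
  using assms(3,4) by (rule alternating_nearest_points_convergent)

end
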